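(* Let $n\ge1$ be an integer, let $z_1,\dots,z_n\in\mathbb{C}$ be fixed points with $|z_j|>1$ for all $j$, and put $$k_n=\sum_{j=1}^n\frac{|z_j|+1}{|z_j|-1}.$$ Let $c>0$ and $f\in\mathcal{F}_c\cap\mathcal{R}_n$. Then $c/k_n\le1/2$ and $$\|f\|\le\frac{k_n}{2c}\left(1+\sqrt{1-\frac{4c^2}{k_n^2}}\right),\qquad\text{where }\|f\|=\sup_{z\in\partial\mathbb{D}}|f(z)|.$$ Consequently the family $\mathcal{F}_c\cap\mathcal{R}_n$ is uniformly bounded on the unit disk $\mathbb{D}$ and in particular normal there.
   Context: $\mathbb{D}=\{z\in\mathbb{C}:|z|<1\}$, and $\mathcal{M}(\mathbb{D})$ is the set of all meromorphic functions in $\mathbb{D}$. For $f\in\mathcal{M}(\mathbb{D})$ the spherical derivative is $f^{\sharp}(z)=\frac{|f'(z)|}{1+|f(z)|^2}$, extended continuously to the poles of $f$. For $c>0$, $\mathcal{F}_c=\{f\in\mathcal{M}(\mathbb{D}): f^{\sharp}(z)\ge c\text{ for all }z\in\mathbb{D}\}$. $\mathcal{R}_n$ is the class of rational functions $f=p_n/q_n$ where $p_n$ is a complex polynomial of degree at most $n$ and $q_n(z)=\prod_{j=1}^n(z-z_j)$, with the points $z_j$ fixed once and for all; $f\in\mathcal{F}_c\cap\mathcal{R}_n$ means $f\in\mathcal{R}_n$ and its restriction to $\mathbb{D}$ lies in $\mathcal{F}_c$. *)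

theory Defs
  imports "HOL-Complex_Analysis.Complex_Analysis"
begin

(* Meromorphic functions on U are represented by total functions that are
   nicely_meromorphic_on U: removable singularities are filled in and the value at a
   pole is 0 by convention. All notions below on an open set U depend only on the
   restriction of the functions to U. *)

definition spherical_deriv :: "(complex \<Rightarrow> complex) \<Rightarrow> complex \<Rightarrow> real" where
  "spherical_deriv f z =
     (if is_pole f z
      then Lim (at z) (\<lambda>w. norm (deriv f w) / (1 + (norm (f w))\<^sup>2))
      else norm (deriv f z) / (1 + (norm (f z))\<^sup>2))"

definition spherical_class :: "real \<Rightarrow> (complex \<Rightarrow> complex) set" where
  "spherical_class c =
     {f. f nicely_meromorphic_on ball 0 1 \<and> (\<forall>z\<in>ball 0 1. c \<le> spherical_deriv f z)}"

(* The nodes z 1, ..., z n need not be distinct; at a node the HOL value of the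
   quotient is 0, which is irrelevant on the closed unit disk since all nodes are
   assumed to lie outside of it. *)
definition rational_class :: "nat \<Rightarrow> (nat \<Rightarrow> complex) \<Rightarrow> (complex \<Rightarrow> complex) set" where
  "rational_class n z =
     {f. \<exists>p :: complex poly. degree p \<le> n \<and>
           f = (\<lambda>w. poly p w / (\<Prod>j=1..n. (w - z j)))}"

definition node_const :: "nat \<Rightarrow> (nat \<Rightarrow> complex) \<Rightarrow> real" where
  "node_const n z = (\<Sum>j=1..n. (norm (z j) + 1) / (norm (z j) - 1))"

definition circle_norm :: "(complex \<Rightarrow> complex) \<Rightarrow> real" where
  "circle_norm f = (SUP w\<in>sphere 0 1. norm (f w))"

(* Extended complex plane: None is the point at infinity. *)
definition ext_value :: "(complex \<Rightarrow> complex) \<Rightarrow> complex \<Rightarrow> complex option" where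
  "ext_value f z = (if is_pole f z then None else Some (f z))"

fun chordal_dist :: "complex option \<Rightarrow> complex option \<Rightarrow> real" where
  "chordal_dist (Some a) (Some b) =
     norm (a - b) / (sqrt (1 + (norm a)\<^sup>2) * sqrt (1 + (norm b)\<^sup>2))"
| "chordal_dist (Some a) None = 1 / sqrt (1 + (norm a)\<^sup>2)"
| "chordal_dist None (Some b) = 1 / sqrt (1 + (norm b)\<^sup>2)"
| "chordal_dist None None = 0"

(* Normality in the sense of Montel for meromorphic functions on a domain U:
   spherically uniform convergence on compact subsets of U, the limit being either
   meromorphic or identically infinity. *)
definition normal_family_on :: "(complex \<Rightarrow> complex) set \<Rightarrow> complex set \<Rightarrow> bool" where
  "normal_family_on F U \<longleftrightarrow>
     (\<forall>f\<in>F. f nicely_meromorphic_on U) \<and>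
     (\<forall>f :: nat \<Rightarrow> complex \<Rightarrow> complex. range f \<subseteq> F \<longrightarrow>
       (\<exists>(r :: nat \<Rightarrow> nat) (g :: complex \<Rightarrow> complex option).
          strict_mono r \<and>
          ((\<exists>h. h nicely_meromorphic_on U \<and> (\<forall>w\<in>U. g w = ext_value h w)) \<or>
           (\<forall>w\<in>U. g w = None)) \<and>
          (\<forall>K. compact K \<and> K \<subseteq> U \<longrightarrow>
             uniform_limit K (\<lambda>k w. chordal_dist (ext_value (f (r k)) w) (g w)) (\<lambda>_. 0)
               sequentially)))"

end

theory Submission
  imports Defs
begin

text \<open>
  Let \<open>M = \<parallel>f\<parallel>\<close> be attained at a point \<open>w\<close> of the unit circle. By continuity the lower bound on
  the spherical derivative persists at \<open>w\<close>, so \<open>c (1 + M\<^sup>2) \<le> \<bar>f' w\<bar>\<close>. A Bernstein-type inequality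
  at \<open>w\<close> (lemma \<open>bernstein_at_max\<close>) gives \<open>\<bar>f' w\<bar> \<le> k\<^sub>n M\<close>. Hence \<open>c M\<^sup>2 - k\<^sub>n M + c \<le> 0\<close>; the
  discriminant of this quadratic must be nonnegative, and \<open>M\<close> is at most its larger root.

  For the Bernstein inequality write \<open>f = p / q\<close>, \<open>q u = \<Prod>(u - z\<^sub>j)\<close>, and compare with
  \<open>Q u = \<Prod>(1 - cnj z\<^sub>j u)\<close>, which has the same modulus as \<open>q\<close> on the unit circle but all its zeros
  inside the disk. So \<open>p / Q\<close> is analytic outside the disk, including infinity because
  \<open>deg p \<le> n\<close>, and the maximum principle gives \<open>\<bar>p / Q\<bar> \<le> M\<close> there (lemma
  \<open>exterior_bound_reflected_denominator\<close>). If \<open>M > 0\<close>, then at \<open>w\<close> both \<open>\<bar>f\<bar>\<close> on the closed disk and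
  \<open>\<bar>p / Q\<bar>\<close> on the closed exterior are maximal. Thus the number \<open>w f' w / f w\<close> is real and
  nonnegative by maximality of \<open>\<bar>f\<bar>\<close>, and the outward radial derivative of \<open>log \<bar>p / Q\<bar>\<close> is at
  most 0. Subtracting logarithmic derivatives leaves
  \<open>\<bar>f' w / f w\<bar> \<le> Re (\<Sum> (z\<^sub>j + w) / (z\<^sub>j - w)) \<le> k\<^sub>n\<close>.

  Normality follows from Montel's theorem for uniformly bounded holomorphic families, because the
  chordal distance is at most the Euclidean one.
\<close>

section \<open>First-order conditions at a maximum of the modulus\<close>

lemma norm_square_derivative_along_curve:
  fixes F :: "complex \<Rightarrow> complex" and \<gamma> :: "real \<Rightarrow> complex"
  assumes "(\<gamma> has_vector_derivative v) (at t)"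
    and "(F has_field_derivative F (\<gamma> t) * L) (at (\<gamma> t))"
  shows "((\<lambda>s. (norm (F (\<gamma> s)))\<^sup>2) has_real_derivative 2 * (norm (F (\<gamma> t)))\<^sup>2 * Re (v * L)) (at t)"
proof -
  have "((F \<circ> \<gamma>) has_vector_derivative (v * (F (\<gamma> t) * L))) (at t)"
    by (rule field_vector_diff_chain_at[OF assms])
  then have d: "((F \<circ> \<gamma>) has_derivative (\<lambda>h. h *\<^sub>R (v * (F (\<gamma> t) * L)))) (at t)"
    by (simp add: has_vector_derivative_def)
  have inner: "a \<bullet> (h *\<^sub>R (v * (a * L))) + (h *\<^sub>R (v * (a * L))) \<bullet> a = 2 * (norm a)\<^sup>2 * Re (v * L) * h" for a h
    unfolding inner_complex_def cmod_power2 by (simp add: power2_eq_square algebra_simps)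
  show ?thesis
    using has_derivative_inner[OF d d]
    unfolding has_field_derivative_def o_def inner power2_norm_eq_inner[symmetric] .
qed

lemma tangential_derivative_at_max:
  assumes w: "norm w = 1"
    and F: "(F has_field_derivative F w * L) (at w)" "F w \<noteq> 0"
    and max: "\<And>u. norm u = 1 \<Longrightarrow> norm (F u) \<le> norm (F w)"
  shows "Im (w * L) = 0"
proof -
  let ?\<gamma> = "\<lambda>t. w * exp (\<i> * complex_of_real t)"
  have "(?\<gamma> has_vector_derivative w * (\<i> * 1)) (at 0)"
    by (rule has_vector_derivative_real_field) (auto intro!: derivative_eq_intros)
  from norm_square_derivative_along_curve[OF this, of F L] F(1)
  have d: "((\<lambda>s. (norm (F (?\<gamma> s)))\<^sup>2) has_real_derivative 2 * (norm (F w))\<^sup>2 * Re (w * \<i> * L)) (at 0)"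
    by simp
  have "norm (F (?\<gamma> t)) \<le> norm (F w)" for t
    by (rule max) (simp add: norm_mult w)
  then have "(norm (F (?\<gamma> t)))\<^sup>2 \<le> (norm (F (?\<gamma> 0)))\<^sup>2" for t
    by (intro power_mono) simp_all
  then have "2 * (norm (F w))\<^sup>2 * Re (w * \<i> * L) = 0"
    by (intro DERIV_local_max[OF d, of 1]) simp_all
  with F(2) have "Re (w * \<i> * L) = 0" by simp
  moreover have "Re (w * \<i> * L) = - Im (w * L)" by simp
  ultimately show ?thesis by linarith
qed

lemma radial_square_derivative:
  assumes "(F has_field_derivative F w * L) (at w)"
  shows "((\<lambda>r. (norm (F (of_real r * w)))\<^sup>2) has_real_derivative 2 * (norm (F w))\<^sup>2 * Re (w * L)) (at 1)"
proof -
  have "((\<lambda>r. of_real r * w) has_vector_derivative w) (at 1)"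
    by (auto intro!: derivative_eq_intros)
  from norm_square_derivative_along_curve[OF this, of F L] assms show ?thesis by simp
qed

lemma radial_derivative_at_exterior_max:
  assumes "(F has_field_derivative F w * L) (at w)" "F w \<noteq> 0"
    and max: "\<And>r::real. r > 1 \<Longrightarrow> norm (F (of_real r * w)) \<le> norm (F w)"
  shows "Re (w * L) \<le> 0"
proof (rule ccontr)
  assume "\<not> Re (w * L) \<le> 0"
  with assms(2) have "2 * (norm (F w))\<^sup>2 * Re (w * L) > 0" by simp
  from DERIV_pos_inc_right[OF radial_square_derivative[OF assms(1)] this]
  obtain d where d: "d > 0" "\<And>h. 0 < h \<Longrightarrow> h < d \<Longrightarrow> (norm (F w))\<^sup>2 < (norm (F (of_real (1 + h) * w)))\<^sup>2"
    by auto
  have "(norm (F (of_real (1 + d/2) * w)))\<^sup>2 \<le> (norm (F w))\<^sup>2"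
    using d(1) by (intro power_mono max) auto
  moreover have "(norm (F w))\<^sup>2 < (norm (F (of_real (1 + d/2) * w)))\<^sup>2"
    using d(1) by (intro d(2)) auto
  ultimately show False by linarith
qed

lemma radial_derivative_at_interior_max:
  assumes "(F has_field_derivative F w * L) (at w)" "F w \<noteq> 0"
    and max: "\<And>r::real. 0 < r \<Longrightarrow> r < 1 \<Longrightarrow> norm (F (of_real r * w)) \<le> norm (F w)"
  shows "Re (w * L) \<ge> 0"
proof (rule ccontr)
  assume "\<not> Re (w * L) \<ge> 0"
  with assms(2) have "2 * (norm (F w))\<^sup>2 * Re (w * L) < 0" by (simp add: mult_pos_neg)
  from DERIV_neg_dec_left[OF radial_square_derivative[OF assms(1)] this]
  obtain d where d: "d > 0" "\<And>h. 0 < h \<Longrightarrow> h < d \<Longrightarrow> (norm (F w))\<^sup>2 < (norm (F (of_real (1 - h) * w)))\<^sup>2"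
    by auto
  define h where "h = min (d/2) (1/2)"
  have h: "0 < h" "h < d" "h < 1" using d(1) by (auto simp: h_def min_def)
  have "(norm (F (of_real (1 - h) * w)))\<^sup>2 \<le> (norm (F w))\<^sup>2"
    using h by (intro power_mono max) auto
  with d(2)[OF h(1,2)] show False by linarith
qed

section \<open>A Bernstein inequality at a maximum point on the unit circle\<close>

lemma maximum_modulus_unit_disk:
  assumes holo: "f holomorphic_on cball 0 1"
    and bound: "\<And>u::complex. norm u = 1 \<Longrightarrow> norm (f u) \<le> M" and u: "norm u \<le> 1"
  shows "norm (f u) \<le> M"
proof (rule maximum_modulus_frontier[of f "cball 0 1"])
  show "f holomorphic_on interior (cball 0 1)"
    by (rule holomorphic_on_subset[OF holo interior_subset])
  show "continuous_on (closure (cball 0 1)) f"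
    using holomorphic_on_imp_continuous_on[OF holo] by simp
qed (use bound u in auto)

lemma prod_nodes_nonzero:
  fixes z :: "'i \<Rightarrow> complex"
  assumes "finite I" "\<And>j. j \<in> I \<Longrightarrow> norm (z j) > 1" "norm u \<le> 1"
  shows "(\<Prod>j\<in>I. u - z j) \<noteq> 0"
  using assms by fastforce

lemma rational_holomorphic_on_disk:
  assumes "finite I" "\<And>j. j \<in> I \<Longrightarrow> norm (z j) > 1" "S \<subseteq> cball 0 1"
  shows "(\<lambda>u. poly p u / (\<Prod>j\<in>I. u - z j)) holomorphic_on S"
  using assms prod_nodes_nonzero[OF assms(1,2)]
  by (intro holomorphic_intros) (auto simp del: prod_zero_iff simp: subset_iff)

lemma norm_reflected_factor_on_circle:
  fixes a u :: complex
  assumes "norm u = 1"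
  shows "norm (1 - cnj a * u) = norm (u - a)"
proof -
  have "u * cnj u = 1" using assms complex_norm_square[of u] by simp
  then have "1 - cnj a * u = u * cnj (u - a)" by (simp add: algebra_simps)
  then show ?thesis by (simp only: norm_mult complex_mod_cnj assms mult_1_left)
qed

text \<open>
  The maximum principle in the exterior of the disk, applied to \<open>p / \<Prod>(1 - cnj z\<^sub>j v)\<close>. Under
  \<open>v \<mapsto> 1 / cnj v\<close> this quotient becomes the conjugate of \<open>R / \<Prod>(u - z\<^sub>j)\<close>, where \<open>R\<close> is the
  conjugate-reversed polynomial of \<open>p\<close> with respect to degree \<open>card I\<close>; the degree bound is what
  makes \<open>R\<close> a polynomial, that is, what makes the quotient regular at infinity.
\<close>
lemma exterior_bound_reflected_denominator:
  fixes z :: "'i \<Rightarrow> complex"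
  assumes I: "finite I" and z: "\<And>j. j \<in> I \<Longrightarrow> norm (z j) > 1"
    and deg: "degree p \<le> card I"
    and M: "\<And>u. norm u = 1 \<Longrightarrow> norm (poly p u) \<le> M * norm (\<Prod>j\<in>I. u - z j)"
    and v: "norm v \<ge> 1"
  shows "norm (poly p v) \<le> M * norm (\<Prod>j\<in>I. 1 - cnj (z j) * v)"
proof -
  let ?n = "card I"
  define R where "R = (\<Sum>i\<le>?n. monom (cnj (coeff p i)) (?n - i))"
  define q where "q = (\<lambda>u. \<Prod>j\<in>I. u - z j)"
  define Q where "Q = (\<lambda>u. \<Prod>j\<in>I. 1 - cnj (z j) * u)"
  have p_sum: "poly p x = (\<Sum>i\<le>?n. coeff p i * x ^ i)" for x
    by (subst poly_altdef, rule sum.mono_neutral_left)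
       (use deg in \<open>auto intro: le_degree\<close>)
  have R_refl: "poly R u = u ^ ?n * cnj (poly p (1 / cnj u))" if "u \<noteq> 0" for u
    unfolding p_sum R_def using that
    by (simp add: poly_sum poly_monom sum_distrib_left power_diff power_divide field_simps)
  have q_refl: "q u = u ^ ?n * cnj (Q (1 / cnj u))" if "u \<noteq> 0" for u
  proof -
    have "q u = (\<Prod>j\<in>I. u * cnj (1 - cnj (z j) * (1 / cnj u)))"
      unfolding q_def using that by (intro prod.cong) (auto simp: field_simps)
    also have "\<dots> = u ^ ?n * cnj (Q (1 / cnj u))"
      unfolding Q_def by (simp only: prod.distrib prod_constant cnj_prod)
    finally show ?thesis .
  qed
  have qnz: "q u \<noteq> 0" if "norm u \<le> 1" for u
    unfolding q_def using prod_nodes_nonzero[OF I z that] .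
  have holo: "(\<lambda>u. poly R u / q u) holomorphic_on cball 0 1"
    unfolding q_def by (rule rational_holomorphic_on_disk[OF I z]) auto
  have circ: "norm (poly R u / q u) \<le> M" if u: "norm u = 1" for u
  proof -
    have "u * cnj u = 1" using u complex_norm_square[of u] by simp
    then have inv: "1 / cnj u = u" by (metis mult_zero_right nonzero_eq_divide_eq zero_neq_one)
    have "u \<noteq> 0" using u by auto
    then have "norm (poly R u) = norm (poly p u)"
      using R_refl[of u] by (simp add: inv norm_mult norm_power u)
    also have "\<dots> \<le> M * norm (q u)" using M[OF u] by (simp add: q_def)
    finally show ?thesis using qnz[of u] u by (simp add: norm_divide divide_le_eq)
  qed
  define u where "u = 1 / cnj v"
  have v0: "v \<noteq> 0" using v by auto
  have u: "norm u \<le> 1" "u \<noteq> 0" "1 / cnj u = v"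
    using v v0 by (auto simp: u_def norm_divide divide_le_eq)
  have "norm (poly R u / q u) \<le> M"
    by (rule maximum_modulus_unit_disk[OF holo circ u(1)])
  then have "norm (poly R u) \<le> M * norm (q u)"
    using qnz[OF u(1)] by (simp add: norm_divide divide_le_eq)
  then have "norm u ^ ?n * norm (poly p v) \<le> norm u ^ ?n * (M * norm (Q v))"
    unfolding R_refl[OF u(2)] q_refl[OF u(2)] u(3)
    by (simp add: norm_mult norm_power mult_ac)
  then show ?thesis using u(2) by (simp add: Q_def)
qed

text \<open>
  The left-hand side is the contribution of one node to the difference of the logarithmic
  derivatives of \<open>\<Prod>(1 - cnj z\<^sub>j u)\<close> and \<open>\<Prod>(u - z\<^sub>j)\<close>: on the circle the first term is
  \<open>cnj (a / (a - w))\<close>, the second \<open>w / (a - w)\<close>.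
\<close>
lemma node_logarithmic_derivative_bound:
  fixes a w :: complex
  assumes w: "norm w = 1" and a: "norm a > 1"
  shows "Re (w * (- cnj a / (1 - cnj a * w) - 1 / (w - a))) \<le> (norm a + 1) / (norm a - 1)"
proof -
  have ww: "cnj w * w = 1" using w complex_norm_square[of w] by (simp add: mult.commute)
  have ne: "a - w \<noteq> 0" "w - a \<noteq> 0" "w \<noteq> 0" "cnj (a - w) \<noteq> 0" using w a by auto
  have eq: "1 - cnj a * w = - w * cnj (a - w)" using ww by (simp add: algebra_simps)
  have "w * (- cnj a / (- w * d)) = cnj a / d" for d
    using ne by (cases "d = 0") (auto simp: field_simps)
  then have e1: "w * (- cnj a / (1 - cnj a * w)) = cnj (a / (a - w))"
    unfolding eq complex_cnj_divide .
  have e2: "w * (1 / (w - a)) = - (w / (a - w))"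
    using ne by (simp add: field_simps)
  have "Re (w * (- cnj a / (1 - cnj a * w) - 1 / (w - a))) = Re (a / (a - w)) + Re (w / (a - w))"
    unfolding right_diff_distrib e1 e2 by (simp del: complex_cnj_divide)
  also have "\<dots> = Re ((a + w) / (a - w))" by (simp add: add_divide_distrib)
  also have "\<dots> \<le> norm ((a + w) / (a - w))" by (rule complex_Re_le_cmod)
  also have "\<dots> \<le> (norm a + 1) / (norm a - 1)"
    unfolding norm_divide using norm_triangle_ineq[of a w] norm_triangle_ineq2[of a w] w a
    by (intro frac_le) auto
  finally show ?thesis .
qed

lemma logarithmic_derivative_divide:
  fixes p q :: "complex \<Rightarrow> complex"
  assumes "(p has_field_derivative p w * Lp) (at w)" "(q has_field_derivative q w * Lq) (at w)"
    and "q w \<noteq> 0"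
  shows "((\<lambda>u. p u / q u) has_field_derivative p w / q w * (Lp - Lq)) (at w)"
proof -
  have "(p w * Lp * q w - p w * (q w * Lq)) / (q w * q w) = p w / q w * (Lp - Lq)"
    using assms(3) by (simp add: field_simps)
  with DERIV_divide[OF assms] show ?thesis by metis
qed

text \<open>
  Maximality of \<open>\<bar>f\<bar>\<close> on the closed disk shows that \<open>w f' w / f w\<close> equals its nonnegative real part,
  but bounds it only from below. The upper bound comes from the competing function \<open>G = p / Q\<close>, which
  has the modulus of \<open>f\<close> on the circle and whose modulus on the closed exterior is maximal at \<open>w\<close>.
  The difference of the two logarithmic derivatives does not involve \<open>p\<close>.
\<close>
lemma bernstein_at_max:
  fixes z :: "'i \<Rightarrow> complex"
  assumes I: "finite I" and z: "\<And>j. j \<in> I \<Longrightarrow> norm (z j) > 1"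
    and deg: "degree p \<le> card I"
    and f: "f = (\<lambda>u. poly p u / (\<Prod>j\<in>I. u - z j))"
    and w: "norm w = 1" and max: "\<And>u. norm u = 1 \<Longrightarrow> norm (f u) \<le> norm (f w)"
  shows "norm (deriv f w) \<le> (\<Sum>j\<in>I. (norm (z j) + 1) / (norm (z j) - 1)) * norm (f w)"
proof -
  define q where "q = (\<lambda>u. \<Prod>j\<in>I. u - z j)"
  have qnz: "q u \<noteq> 0" if "norm u \<le> 1" for u
    unfolding q_def using prod_nodes_nonzero[OF I z that] .
  have holo: "f holomorphic_on cball 0 1"
    unfolding f by (rule rational_holomorphic_on_disk[OF I z]) auto
  have disk: "norm (f u) \<le> norm (f w)" if "norm u \<le> 1" for u
    by (rule maximum_modulus_unit_disk[OF holo max that])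
  show ?thesis
  proof (cases "f w = 0")
    case True
    have "poly p u = 0" if "norm u \<le> 1" for u
    proof -
      have "f u = 0" using disk[OF that] True by simp
      then show ?thesis using qnz[OF that] by (simp add: f q_def)
    qed
    then have "cball 0 1 \<subseteq> {u. poly p u = 0}" by auto
    moreover have "infinite (cball (0::complex) 1)"
      using uncountable_cball[of 1 "0::complex"] countable_finite by auto
    ultimately have "p = 0" using poly_roots_finite finite_subset by blast
    then show ?thesis by (simp add: f)
  next
    case False
    define Q where "Q = (\<lambda>u. \<Prod>j\<in>I. 1 - cnj (z j) * u)"
    define Lp where "Lp = poly (pderiv p) w / poly p w"
    define Lq where "Lq = (\<Sum>j\<in>I. 1 / (w - z j))"
    define LQ where "LQ = (\<Sum>j\<in>I. - cnj (z j) / (1 - cnj (z j) * w))"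
    let ?M = "norm (f w)"
    have f': "f = (\<lambda>u. poly p u / q u)" by (simp add: f q_def)
    have nQ: "norm (Q u) = norm (q u)" if "norm u = 1" for u
      unfolding Q_def q_def prod_norm[symmetric] norm_reflected_factor_on_circle[OF that] ..
    have qw: "q w \<noteq> 0" and Qw: "Q w \<noteq> 0" using qnz[of w] nQ[OF w] w by auto
    have pw: "poly p w \<noteq> 0" using False by (auto simp: f')
    have dp: "(poly p has_field_derivative poly p w * Lp) (at w)"
      using poly_DERIV[of p w] pw by (simp add: Lp_def)
    have dq: "(q has_field_derivative q w * Lq) (at w)"
      unfolding q_def Lq_def using qw I
      by (intro has_field_derivative_prod') (auto simp: q_def intro!: derivative_eq_intros)
    have dQ: "(Q has_field_derivative Q w * LQ) (at w)"
      unfolding Q_def LQ_def using Qw I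
      by (intro has_field_derivative_prod') (auto simp: Q_def intro!: derivative_eq_intros)
    have df: "(f has_field_derivative f w * (Lp - Lq)) (at w)"
      unfolding f' by (rule logarithmic_derivative_divide[OF dp dq qw])
    define G where "G = (\<lambda>u. poly p u / Q u)"
    have dG: "(G has_field_derivative G w * (Lp - LQ)) (at w)"
      unfolding G_def by (rule logarithmic_derivative_divide[OF dp dQ Qw])
    have Gw: "norm (G w) = ?M" by (simp add: G_def f' norm_divide nQ[OF w])
    have pbound: "norm (poly p u) \<le> ?M * norm (q u)" if "norm u = 1" for u
      using max[OF that] qnz[of u] that by (simp add: f' norm_divide divide_le_eq)
    have ext: "norm (poly p u) \<le> ?M * norm (Q u)" if "norm u \<ge> 1" for u
      unfolding Q_def
      by (intro exterior_bound_reflected_denominator I z deg pbound[unfolded q_def] that)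
    have "norm (G u) \<le> norm (G w)" if u: "norm u \<ge> 1" for u
    proof (cases "Q u = 0")
      case False
      then show ?thesis using ext[OF u]
        by (simp add: Gw) (simp add: G_def norm_divide divide_le_eq)
    qed (simp add: G_def)
    then have ReG: "Re (w * (Lp - LQ)) \<le> 0"
      by (intro radial_derivative_at_exterior_max[OF dG]) (use Gw False w in \<open>auto simp: norm_mult\<close>)
    have Re0: "Re (w * (Lp - Lq)) \<ge> 0"
      by (rule radial_derivative_at_interior_max[OF df False]) (auto intro!: disk simp: norm_mult w)
    have Im0: "Im (w * (Lp - Lq)) = 0"
      by (rule tangential_derivative_at_max[OF w df False max])
    have "norm (Lp - Lq) = norm (w * (Lp - Lq))" by (simp add: norm_mult w)
    also have "\<dots> = Re (w * (Lp - Lq))" using Re0 Im0 by (simp add: cmod_eq_Re)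
    also have "\<dots> = Re (w * (Lp - LQ)) + Re (w * (LQ - Lq))" by (simp add: algebra_simps)
    also have "\<dots> \<le> Re (w * (LQ - Lq))" using ReG by simp
    also have "\<dots> = (\<Sum>j\<in>I. Re (w * (- cnj (z j) / (1 - cnj (z j) * w) - 1 / (w - z j))))"
      unfolding LQ_def Lq_def sum_subtractf[symmetric] sum_distrib_left Re_sum ..
    also have "\<dots> \<le> (\<Sum>j\<in>I. (norm (z j) + 1) / (norm (z j) - 1))"
      by (intro sum_mono node_logarithmic_derivative_bound w z)
    finally have "norm (Lp - Lq) \<le> (\<Sum>j\<in>I. (norm (z j) + 1) / (norm (z j) - 1))" .
    then have "?M * norm (Lp - Lq) \<le> ?M * (\<Sum>j\<in>I. (norm (z j) + 1) / (norm (z j) - 1))"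
      by (rule mult_left_mono) simp
    then show ?thesis using DERIV_imp_deriv[OF df] by (simp add: norm_mult mult_ac)
  qed
qed

section \<open>The sup norm bound\<close>

lemma quadratic_bound:
  fixes c k M :: real
  assumes c: "c > 0" and M: "M \<ge> 0" and q: "c * (1 + M\<^sup>2) \<le> k * M"
  shows "c / k \<le> 1 / 2" "M \<le> k / (2 * c) * (1 + sqrt (1 - 4 * c\<^sup>2 / k\<^sup>2))"
proof -
  have "0 < c * (1 + M\<^sup>2)" using c by (simp add: add_pos_nonneg)
  with q have "0 < k * M" by linarith
  with M have M0: "M > 0" and k0: "k > 0" by (auto simp: zero_less_mult_iff)
  have "0 \<le> c * (M - 1)\<^sup>2" using c by simp
  with q have "2 * c * M \<le> k * M" by (simp add: power2_eq_square algebra_simps)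
  with M0 have ck: "2 * c \<le> k" by simp
  have "(2 * c * M - k)\<^sup>2 = 4 * c * (c * (1 + M\<^sup>2) - k * M) + (k\<^sup>2 - 4 * c\<^sup>2)"
    by (simp add: power2_eq_square algebra_simps)
  also have "\<dots> \<le> k\<^sup>2 - 4 * c\<^sup>2" using q c by (simp add: mult_nonneg_nonpos)
  finally have "2 * c * M - k \<le> sqrt (k\<^sup>2 - 4 * c\<^sup>2)" by (rule real_le_rsqrt)
  also have "k\<^sup>2 - 4 * c\<^sup>2 = k\<^sup>2 * (1 - 4 * c\<^sup>2 / k\<^sup>2)" using k0 by (simp add: field_simps)
  also have "sqrt \<dots> = k * sqrt (1 - 4 * c\<^sup>2 / k\<^sup>2)" using k0 by (simp add: real_sqrt_mult)
  finally have "2 * c * M \<le> k * (1 + sqrt (1 - 4 * c\<^sup>2 / k\<^sup>2))" by (simp add: algebra_simps)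
  then show "M \<le> k / (2 * c) * (1 + sqrt (1 - 4 * c\<^sup>2 / k\<^sup>2))"
    using c by (simp add: field_simps)
  show "c / k \<le> 1 / 2" using k0 ck by (auto simp: field_simps)
qed

text \<open>
  The class only controls the open disk; the maximum point lies on the circle, where the bound is
  inherited by continuity since \<open>f\<close> is holomorphic across it.
\<close>
lemma spherical_class_derivative_bound:
  assumes holo: "f holomorphic_on S" and S: "open S" "cball 0 1 \<subseteq> S"
    and f: "f \<in> spherical_class c" and w: "norm w \<le> 1"
  shows "c * (1 + (norm (f w))\<^sup>2) \<le> norm (deriv f w)"
proof -
  have pos: "1 + (norm x)\<^sup>2 > 0" for x :: complex by (simp add: add_pos_nonneg)
  have nz: "1 + (norm x)\<^sup>2 \<noteq> 0" for x :: complex using pos[of x] by linarith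
  have "c \<le> norm (deriv f w) / (1 + (norm (f w))\<^sup>2)"
  proof (rule continuous_ge_on_closure[where S = "ball 0 1" and x = w
        and f = "\<lambda>u. norm (deriv f u) / (1 + (norm (f u))\<^sup>2)"])
    have "continuous_on S (\<lambda>u. norm (deriv f u) / (1 + (norm (f u))\<^sup>2))"
      by (intro continuous_intros holomorphic_on_imp_continuous_on holo holomorphic_deriv S ballI nz)
    then show "continuous_on (closure (ball 0 1)) (\<lambda>u. norm (deriv f u) / (1 + (norm (f u))\<^sup>2))"
      by (rule continuous_on_subset) (use S in auto)
    show "w \<in> closure (ball 0 1)" using w by simp
    fix u :: complex assume u: "u \<in> ball 0 1"
    then have "u \<in> S" using S(2) ball_subset_cball by blast
    then have "\<not> is_pole f u" using not_is_pole_holomorphic[OF S(1) _ holo] by blast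
    moreover have "c \<le> spherical_deriv f u"
      using f u unfolding spherical_class_def by blast
    ultimately show "c \<le> norm (deriv f u) / (1 + (norm (f u))\<^sup>2)"
      by (simp add: spherical_deriv_def)
  qed
  with pos[of "f w"] show ?thesis by (simp add: pos_le_divide_eq)
qed

lemma circle_norm_attained:
  assumes "continuous_on (sphere 0 1) f"
  obtains w where "norm w = 1" "circle_norm f = norm (f w)" "\<And>u. norm u = 1 \<Longrightarrow> norm (f u) \<le> norm (f w)"
proof -
  have "continuous_on (sphere 0 1) (\<lambda>u. norm (f u))" using assms by (intro continuous_intros)
  then obtain w where w: "w \<in> sphere 0 1" "\<And>u. u \<in> sphere 0 1 \<Longrightarrow> norm (f u) \<le> norm (f w)"
    using continuous_attains_sup[of "sphere (0::complex) 1" "\<lambda>u. norm (f u)"] by auto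
  have "circle_norm f = norm (f w)"
    unfolding circle_norm_def using w by (intro cSup_eq_maximum) auto
  with w that show ?thesis by auto
qed

lemma rational_spherical_class_bound:
  fixes z :: "nat \<Rightarrow> complex"
  assumes z: "\<And>j. j \<in> {1..n} \<Longrightarrow> norm (z j) > 1" and c: "c > 0"
    and f: "f \<in> spherical_class c \<inter> rational_class n z"
  shows "c / node_const n z \<le> 1 / 2"
    and "circle_norm f \<le> node_const n z / (2 * c) * (1 + sqrt (1 - 4 * c\<^sup>2 / (node_const n z)\<^sup>2))"
    and "norm u \<le> 1 \<Longrightarrow> norm (f u) \<le> circle_norm f"
proof -
  from f obtain p where deg: "degree p \<le> card {1..n}"
    and fp: "f = (\<lambda>u. poly p u / (\<Prod>j\<in>{1..n}. u - z j))"
    by (auto simp: rational_class_def)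
  have fin: "finite {1..n}" by simp
  define S where "S = - (z ` {1..n})"
  have S: "open S"
    unfolding S_def by (intro open_Compl finite_imp_closed) simp
  have "norm u > 1" if "u \<in> z ` {1..n}" for u
    using that z by blast
  then have sub: "cball 0 1 \<subseteq> S" unfolding S_def by force
  have holo: "f holomorphic_on S"
    unfolding fp S_def by (intro holomorphic_intros) auto
  have holo': "f holomorphic_on cball 0 1"
    by (rule holomorphic_on_subset[OF holo sub])
  have cont: "continuous_on (sphere 0 1) f"
    by (rule continuous_on_subset[OF holomorphic_on_imp_continuous_on[OF holo']]) auto
  obtain w where w: "norm w = 1" "circle_norm f = norm (f w)"
      and max: "\<And>u. norm u = 1 \<Longrightarrow> norm (f u) \<le> norm (f w)"
    using circle_norm_attained[OF cont] by blast
  have "c * (1 + (norm (f w))\<^sup>2) \<le> norm (deriv f w)"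
    using spherical_class_derivative_bound[OF holo S sub] f w(1) by auto
  also have "\<dots> \<le> node_const n z * norm (f w)"
    unfolding node_const_def by (rule bernstein_at_max[OF fin z deg fp w(1) max])
  finally have q: "c * (1 + (norm (f w))\<^sup>2) \<le> node_const n z * norm (f w)" .
  show "c / node_const n z \<le> 1 / 2"
    and "circle_norm f \<le> node_const n z / (2 * c) * (1 + sqrt (1 - 4 * c\<^sup>2 / (node_const n z)\<^sup>2))"
    using quadratic_bound[OF c norm_ge_zero q] w(2) by simp_all
  show "norm u \<le> 1 \<Longrightarrow> norm (f u) \<le> circle_norm f"
    unfolding w(2) by (rule maximum_modulus_unit_disk[OF holo' max])
qed

section \<open>Normality of bounded holomorphic families\<close>

lemma chordal_dist_le_norm_diff:
  "chordal_dist (Some a) (Some b) \<le> norm (a - b)"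
proof -
  have "1 * 1 \<le> sqrt (1 + (norm a)\<^sup>2) * sqrt (1 + (norm b)\<^sup>2)"
    by (intro mult_mono) auto
  then have "norm (a - b) / (sqrt (1 + (norm a)\<^sup>2) * sqrt (1 + (norm b)\<^sup>2)) \<le> norm (a - b) / 1"
    by (intro divide_left_mono) auto
  then show ?thesis by simp
qed

lemma chordal_dist_nonneg: "chordal_dist (Some a) (Some b) \<ge> 0"
  by simp

lemma bounded_holomorphic_imp_normal_family:
  assumes U: "open U" and mero: "\<And>f. f \<in> F \<Longrightarrow> f nicely_meromorphic_on U"
    and holo: "\<And>f. f \<in> F \<Longrightarrow> f holomorphic_on U"
    and bound: "\<And>f u. f \<in> F \<Longrightarrow> u \<in> U \<Longrightarrow> norm (f u) \<le> M"
  shows "normal_family_on F U"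
  unfolding normal_family_on_def
proof (intro conjI ballI allI impI)
  fix f :: "nat \<Rightarrow> complex \<Rightarrow> complex" assume f: "range f \<subseteq> F"
  obtain g r where g: "g holomorphic_on U" and r: "strict_mono (r :: nat \<Rightarrow> nat)"
    and lim: "\<And>K. \<lbrakk>compact K; K \<subseteq> U\<rbrakk> \<Longrightarrow> uniform_limit K (f \<circ> r) g sequentially"
    by (rule Montel[OF U holo _ f]) (use bound in blast)+
  have ext: "ext_value h u = Some (h u)" if "h holomorphic_on U" "u \<in> U" for h u
    using not_is_pole_holomorphic[OF U that(2,1)] by (simp add: ext_value_def)
  have "g nicely_meromorphic_on U"
    using g U by (intro analytic_on_imp_nicely_meromorphic_on) (simp add: analytic_on_open)
  moreover have "uniform_limit K (\<lambda>k w. chordal_dist (ext_value (f (r k)) w) (ext_value g w)) (\<lambda>_. 0)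
      sequentially" if K: "compact K" "K \<subseteq> U" for K
  proof (rule uniform_limitI)
    fix e :: real assume "e > 0"
    from uniform_limitD[OF lim[OF K] this]
    show "\<forall>\<^sub>F k in sequentially. \<forall>w\<in>K. dist (chordal_dist (ext_value (f (r k)) w) (ext_value g w)) 0 < e"
    proof eventually_elim
      case (elim k)
      show ?case
      proof
        fix w assume w: "w \<in> K"
        have "f (r k) holomorphic_on U" using f holo by blast
        then have "ext_value (f (r k)) w = Some (f (r k) w)" "ext_value g w = Some (g w)"
          using ext g w K by blast+
        moreover have "norm (f (r k) w - g w) < e" using elim w by (simp add: dist_norm)
        ultimately show "dist (chordal_dist (ext_value (f (r k)) w) (ext_value g w)) 0 < e"
          using chordal_dist_le_norm_diff[of "f (r k) w" "g w"]
            chordal_dist_nonneg[of "f (r k) w" "g w"] by (simp del: chordal_dist.simps)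
      qed
    qed
  qed
  ultimately show "\<exists>(r :: nat \<Rightarrow> nat) (g :: complex \<Rightarrow> complex option).
          strict_mono r \<and>
          ((\<exists>h. h nicely_meromorphic_on U \<and> (\<forall>w\<in>U. g w = ext_value h w)) \<or>
           (\<forall>w\<in>U. g w = None)) \<and>
          (\<forall>K. compact K \<and> K \<subseteq> U \<longrightarrow>
             uniform_limit K (\<lambda>k w. chordal_dist (ext_value (f (r k)) w) (g w)) (\<lambda>_. 0)
               sequentially)"
    using r by (intro exI[of _ r] exI[of _ "ext_value g"]) blast
qed (rule mero)

theorem mainTheorem8:
  fixes n :: nat and z :: "nat \<Rightarrow> complex" and c :: real
  assumes "n \<ge> 1"
    and "\<And>j. j \<in> {1..n} \<Longrightarrow> norm (z j) > 1"
    and "c > 0"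
  shows "(\<forall>f \<in> spherical_class c \<inter> rational_class n z.
            c / node_const n z \<le> 1 / 2 \<and>
            circle_norm f \<le> node_const n z / (2 * c) *
              (1 + sqrt (1 - 4 * c\<^sup>2 / (node_const n z)\<^sup>2))) \<and>
         (\<exists>M :: real. \<forall>f \<in> spherical_class c \<inter> rational_class n z.
            \<forall>w \<in> ball 0 1. norm (f w) \<le> M) \<and>
         normal_family_on (spherical_class c \<inter> rational_class n z) (ball 0 1)"
proof -
  let ?F = "spherical_class c \<inter> rational_class n z"
  define B where "B = node_const n z / (2 * c) * (1 + sqrt (1 - 4 * c\<^sup>2 / (node_const n z)\<^sup>2))"
  have bounds: "c / node_const n z \<le> 1 / 2" "circle_norm f \<le> B"
      "\<And>u. norm u \<le> 1 \<Longrightarrow> norm (f u) \<le> circle_norm f" if "f \<in> ?F" for f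
    unfolding B_def using rational_spherical_class_bound[of n z c f] assms that by blast+
  have disk: "norm (f w) \<le> B" if "f \<in> ?F" "w \<in> ball 0 1" for f w
    using bounds(2)[OF that(1)] bounds(3)[OF that(1), of w] that(2) by simp
  have "normal_family_on ?F (ball 0 1)"
  proof (rule bounded_holomorphic_imp_normal_family)
    fix f assume f: "f \<in> ?F"
    show "f nicely_meromorphic_on ball 0 1" using f by (simp add: spherical_class_def)
    show "f holomorphic_on ball 0 1"
      using f rational_holomorphic_on_disk[OF finite_atLeastAtMost assms(2), where S = "ball 0 1"]
      by (auto simp: rational_class_def)
    show "norm (f u) \<le> B" if "u \<in> ball 0 1" for u using disk[OF f that] .
  qed simp
  then show ?thesis using bounds(1,2) disk unfolding B_def[symmetric] by blast
qed

end
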